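(* Let $\mathcal{L}=\{\ell_1,\dots,\ell_k\}$ be a line arrangement of $k$ lines in $\mathbb{P}^2_{\mathbb{C}}$ with $t_3\neq 0$ and $t_r=0$ for all $r>3$, and assume $k\geq 6$ (i.e. the largest multiplicity $3$ is at most $k/2$). Let $G$ be the Levi graph associated to $\mathcal{L}$. Then: (i) If $k$ is odd, then $G$ has an induced $\mathbf{C}_{2i}$ for all integers $3\le i\leq \left\lfloor\frac{k+9}{4}\right\rfloor$. (ii) If $k$ is even and at least one line of $\mathcal{L}$ contains more than one double point, then $G$ has an induced $\mathbf{C}_{2i}$ for all integers $3\le i\leq \left\lfloor\frac{k+11}{4}\right\rfloor$. (iii) If $k$ is even and every line of $\mathcal{L}$ contains exactly one double point, then $G$ has an induced $\mathbf{C}_{2i}$ for all integers $3\le i\leq \left\lfloor\frac{2k+16}{7}\right\rfloor$.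
   Context: A line arrangement $\mathcal{L}=\{\ell_1,\dots,\ell_k\}$ is a finite collection of $k$ distinct lines in $\mathbb{P}^2_{\mathbb{C}}$. $\mathrm{Sing}(\mathcal{L})$ is the set of points lying on at least two lines of $\mathcal{L}$ (the intersection points). The multiplicity of a point of $\mathrm{Sing}(\mathcal{L})$ is the number of lines of $\mathcal{L}$ through it; a double point is a point of multiplicity $2$. $t_r=t_r(\mathcal{L})$ is the number of points of $\mathrm{Sing}(\mathcal{L})$ of multiplicity exactly $r$. The Levi graph of $\mathcal{L}$ is the bipartite graph with one vertex for each point of $\mathrm{Sing}(\mathcal{L})$ and one vertex for each line of $\mathcal{L}$, a point vertex and a line vertex being adjacent iff the point lies on the line. $\mathbf{C}_n$ denotes the cycle on $n$ vertices; an induced $\mathbf{C}_n$ in a graph is an induced subgraph isomorphic to $\mathbf{C}_n$. *)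

theory Defs
  imports
    "HOL-Analysis.Analysis"
    "Graph_Theory.Pair_Digraph"
    "Graph_Theory.Digraph_Isomorphism"
begin

text \<open>
  The complex projective plane is modelled by the linear subspaces of \<open>complex ^ 3\<close>:
  a point is a subspace of complex dimension 1, a line is a subspace of complex dimension 2,
  and a point lies on a line iff it is contained in it. The constants \<open>vec.subspace\<close> and
  \<open>vec.dim\<close> refer to scalar multiplication by complex numbers (\<open>*s\<close>), whereas the unqualified
  \<open>subspace\<close> and \<open>dim\<close> would refer to the underlying real vector space.
\<close>

definition proj_point :: "(complex ^ 3) set \<Rightarrow> bool" where
  "proj_point p \<longleftrightarrow> vec.subspace p \<and> vec.dim p = 1"

definition proj_line :: "(complex ^ 3) set \<Rightarrow> bool" where
  "proj_line l \<longleftrightarrow> vec.subspace l \<and> vec.dim l = 2"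

definition lies_on :: "(complex ^ 3) set \<Rightarrow> (complex ^ 3) set \<Rightarrow> bool" where
  "lies_on p l \<longleftrightarrow> p \<subseteq> l"

definition line_arrangement :: "(complex ^ 3) set set \<Rightarrow> bool" where
  "line_arrangement L \<longleftrightarrow> finite L \<and> (\<forall>l\<in>L. proj_line l)"

definition multiplicity_of :: "(complex ^ 3) set set \<Rightarrow> (complex ^ 3) set \<Rightarrow> nat" where
  "multiplicity_of L p = card {l \<in> L. lies_on p l}"

definition Sing :: "(complex ^ 3) set set \<Rightarrow> (complex ^ 3) set set" where
  "Sing L = {p. proj_point p \<and> multiplicity_of L p \<ge> 2}"

definition num_points :: "(complex ^ 3) set set \<Rightarrow> nat \<Rightarrow> nat"  (\<open>t\<^bsub>_\<^esub>\<close>) where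
  "t\<^bsub>L\<^esub> r = card {p \<in> Sing L. multiplicity_of L p = r}"

definition double_points_on :: "(complex ^ 3) set set \<Rightarrow> (complex ^ 3) set \<Rightarrow> (complex ^ 3) set set" where
  "double_points_on L l = {p \<in> Sing L. multiplicity_of L p = 2 \<and> lies_on p l}"

text \<open>Undirected graphs are represented as symmetric digraphs.\<close>

definition levi_graph ::
  "(complex ^ 3) set set \<Rightarrow> ((complex ^ 3) set + (complex ^ 3) set) pair_pre_digraph" where
  "levi_graph L = \<lparr> pverts = Inl ` Sing L \<union> Inr ` L,
     parcs = {(Inl p, Inr l) | p l. p \<in> Sing L \<and> l \<in> L \<and> lies_on p l}
           \<union> {(Inr l, Inl p) | p l. p \<in> Sing L \<and> l \<in> L \<and> lies_on p l} \<rparr>"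

text \<open>The cycle on \<open>n\<close> vertices; intended for \<open>n \<ge> 3\<close>.\<close>

definition cycle_graph :: "nat \<Rightarrow> nat pair_pre_digraph" where
  "cycle_graph n = \<lparr> pverts = {..<n},
     parcs = {(a, b). a < n \<and> b < n \<and> (b = (a + 1) mod n \<or> a = (b + 1) mod n)} \<rparr>"

definition has_induced_cycle :: "'a pair_pre_digraph \<Rightarrow> nat \<Rightarrow> bool" where
  "has_induced_cycle G n \<longleftrightarrow>
     (\<exists>H. induced_subgraph H (with_proj G) \<and> digraph_iso H (with_proj (cycle_graph n)))"

lemma pair_bidirected_digraph_levi_graph: "pair_bidirected_digraph (levi_graph L)"
  by unfold_locales (auto simp: levi_graph_def symmetric_def intro!: symI)

lemma pair_graph_cycle_graph:
  assumes "n \<ge> 3"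
  shows "pair_graph (cycle_graph n)"
proof -
  have "finite (parcs (cycle_graph n))"
    by (rule finite_subset[of _ "{..<n} \<times> {..<n}"]) (auto simp: cycle_graph_def)
  moreover have "a \<noteq> Suc a mod n \<and> Suc a mod n \<noteq> a" if "a < n" for a
    using assms that by (cases "Suc a = n") auto
  ultimately show ?thesis
    by unfold_locales (auto simp: cycle_graph_def symmetric_def intro!: symI)
qed

end

theory Submission
  imports Defs
begin

text \<open>
  An induced cycle of length \<open>2 * i\<close> in the Levi graph is a cyclic sequence of \<open>i\<close> lines such that the
  intersection point of two cyclically consecutive lines lies on no further line of the sequence.
  When all multiplicities are at most 3, a pair of lines determines at most one third line through
  its intersection point, so the triple points form a partial Steiner triple system on the lines
  and the problem is combinatorial. Such a sequence is built greedily. Given \<open>m\<close> lines, the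
  next line has to avoid them, the third lines of consecutive pairs, and the third lines of the
  pairs containing the most recent line; a line that closes the cycle also has to avoid the
  third lines of the pairs containing the initial line. In total at most \<open>4 * m - 6\<close> lines are
  excluded, which gives (i). If the first two lines meet in a double point, one fewer is excluded,
  which gives (ii). In (iii) the double points match the lines in pairs, and letting every other
  consecutive pair of the sequence be a matched pair halves the number of excluded third lines of
  consecutive pairs.
\<close>

section \<open>Induced cycles in partial triple systems\<close>

text \<open>Rotation carries membership and distinctness over to all three entries and, together
  with the swap, generates all permutations. So \<open>col\<close> describes unordered triples, and
  two distinct ones share at most one element.\<close>

locale partial_triple_system =
  fixes L :: "'a set" and col :: "'a \<Rightarrow> 'a \<Rightarrow> 'a \<Rightarrow> bool"
  assumes finite_L: "finite L"
    and col_mem: "col a b c \<Longrightarrow> a \<in> L"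
    and col_neq: "col a b c \<Longrightarrow> a \<noteq> b"
    and col_swap: "col a b c \<Longrightarrow> col b a c"
    and col_rotate: "col a b c \<Longrightarrow> col b c a"
    and col_unique: "col a b c \<Longrightarrow> col a b d \<Longrightarrow> c = d"
begin

definition third :: "'a \<Rightarrow> 'a \<Rightarrow> 'a set" where
  "third a b = {c. col a b c}"

fun thirds :: "'a list \<Rightarrow> 'a set" where
  "thirds (x # y # zs) = third x y \<union> thirds (y # zs)"
| "thirds _ = {}"

text \<open>All three elements of a triple may occur if no two of them are neighbours: the common
  point of such lines is no vertex of the resulting Levi cycle.\<close>

definition ind_path :: "'a list \<Rightarrow> bool" where
  "ind_path xs \<longleftrightarrow> distinct xs \<and> set xs \<subseteq> L \<and> thirds xs \<inter> set xs = {}"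

definition ind_cycle :: "'a list \<Rightarrow> bool" where
  "ind_cycle xs \<longleftrightarrow> ind_path xs \<and> length xs \<ge> 3 \<and> third (last xs) (hd xs) \<inter> set xs = {}"

section \<open>Third elements of pairs and bounds on their number\<close>

lemma third_commute: "third a b = third b a"
  using col_swap by (auto simp: third_def)

text \<open>Turns a condition on an old element and a pair containing the new one into a condition
  on the new element, which can be counted.\<close>

lemma third_rotate: "c \<in> third a b \<longleftrightarrow> a \<in> third b c"
  using col_rotate by (auto simp: third_def)

lemma third_subset: "third a b \<subseteq> L"
  using col_mem col_rotate unfolding third_def by blast

lemma finite_third [simp]: "finite (third a b)"
  using finite_subset[OF third_subset finite_L] .

lemma card_third_le: "card (third a b) \<le> 1"
  using col_unique by (auto simp: third_def card_le_Suc0_iff_eq[OF finite_third[unfolded third_def]])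

lemma not_in_third: "a \<notin> third a b" "b \<notin> third a b" "third a a = {}"
  unfolding third_def using col_neq col_rotate by blast+

lemma card_third_Union_le:
  assumes "finite J"
  shows "card (\<Union>j\<in>J. third a j) \<le> card J"
proof -
  have "card (\<Union>j\<in>J. third a j) \<le> (\<Sum>j\<in>J. card (third a j))"
    by (rule card_UN_le[OF assms])
  also have "\<dots> \<le> (\<Sum>j\<in>J. 1)"
    by (intro sum_mono card_third_le)
  finally show ?thesis by simp
qed

lemma thirds_subset: "thirds xs \<subseteq> L"
  by (induction xs rule: thirds.induct) (use third_subset in auto)

lemma finite_thirds [simp]: "finite (thirds xs)"
  using finite_subset[OF thirds_subset finite_L] .

lemma third_subset_thirds: "third a b \<subseteq> thirds (xs @ a # b # ys)"
proof (induction xs)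
  case (Cons x xs)
  then show ?case by (cases xs) auto
qed auto

lemma third_nth_subset_thirds:
  assumes "Suc j < length xs"
  shows "third (xs ! j) (xs ! Suc j) \<subseteq> thirds xs"
  using third_subset_thirds[of "xs ! j" "xs ! Suc j" "take j xs" "drop (Suc (Suc j)) xs"] assms
  by (simp add: Cons_nth_drop_Suc id_take_nth_drop[symmetric])

lemma ind_cycle_nth:
  assumes "ind_cycle xs" "j < length xs"
  shows "third (xs ! j) (xs ! (Suc j mod length xs)) \<inter> set xs = {}"
proof (cases "Suc j = length xs")
  case True
  have "xs \<noteq> []" using assms(2) by auto
  with True have "xs ! j = last xs"
    by (metis diff_Suc_1 last_conv_nth)
  then show ?thesis
    using assms True hd_conv_nth[OF \<open>xs \<noteq> []\<close>] by (simp add: ind_cycle_def)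
next
  case False
  then show ?thesis
    using assms third_nth_subset_thirds[of j xs] by (auto simp: ind_cycle_def ind_path_def)
qed

lemma card_thirds_Cons_le: "xs \<noteq> [] \<Longrightarrow> card (thirds (x # xs)) \<le> Suc (card (thirds xs))"
proof (cases xs)
  case (Cons y ys)
  then have "card (thirds (x # xs)) \<le> card (third x y) + card (thirds xs)"
    by (simp add: card_Un_le)
  with card_third_le[of x y] show ?thesis by linarith
qed auto

section \<open>Greedy extension and closing of paths\<close>

lemma ex_not_in:
  assumes "A \<subseteq> L" "card A < card L"
  obtains y where "y \<in> L" "y \<notin> A"
  using assms by (metis nat_neq_iff subsetI subset_antisym)

text \<open>The only new consecutive pair is \<open>y\<close>, \<open>h\<close>. By rotation an old
  \<open>j\<close> is its third element iff \<open>y\<close> is that of \<open>h\<close>,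
  \<open>j\<close>; for \<open>j = s\<close> this is excluded by \<open>thirds\<close>.\<close>

lemma path_Cons:
  assumes p: "ind_path (h # s # zs)" and y: "y \<in> L" "y \<notin> set (h # s # zs)"
    "y \<notin> thirds (h # s # zs)" "y \<notin> (\<Union>j\<in>set zs. third h j)"
  shows "ind_path (y # h # s # zs)"
proof -
  have "j \<notin> third y h" if "j \<in> set (s # zs)" for j
    using that y(3,4) third_rotate[of j y h] by auto
  then show ?thesis
    using p y not_in_third by (auto simp: ind_path_def)
qed

text \<open>
  Paths grow at the head of the list. The third element of the first two elements already belongs to
  \<open>thirds xs\<close>, hence \<open>tl (tl xs)\<close>.
\<close>
definition blocked :: "'a list \<Rightarrow> 'a set" where
  "blocked xs = set xs \<union> thirds xs \<union> (\<Union>j\<in>set (tl (tl xs)). third (hd xs) j)"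

lemma blocked_subset: "ind_path xs \<Longrightarrow> blocked xs \<subseteq> L"
  using third_subset thirds_subset by (force simp: blocked_def ind_path_def)

lemma card_blocked_le:
  "card (blocked xs) \<le> length xs + card (thirds xs) + (length xs - 2)"
proof -
  have "card (\<Union>j\<in>set (tl (tl xs)). third (hd xs) j) \<le> length xs - 2"
    using order_trans[OF card_third_Union_le card_length, of "tl (tl xs)" "hd xs"]
    by (simp add: numeral_2_eq_2)
  then show ?thesis
    unfolding blocked_def
    using card_Un_le[of "set xs" "thirds xs"] card_length[of xs]
      card_Un_le[of "set xs \<union> thirds xs" "\<Union>j\<in>set (tl (tl xs)). third (hd xs) j"]
    by linarith
qed

lemma path_Cons_blocked:
  assumes "ind_path xs" "length xs \<ge> 2" "y \<in> L" "y \<notin> blocked xs"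
  shows "ind_path (y # xs)"
proof -
  obtain h s zs where "xs = h # s # zs"
    using assms(2) by (metis One_nat_def Suc_1 Suc_le_length_iff)
  then show ?thesis
    using path_Cons[of h s zs y] assms by (auto simp: blocked_def)
qed

lemma path_extend:
  assumes "ind_path xs" "length xs \<ge> 2" "card L > 2 * length xs - 2 + card (thirds xs)"
  obtains y where "y \<in> L" "ind_path (y # xs)"
proof -
  have "card (blocked xs) < card L"
    using card_blocked_le[of xs] assms by linarith
  then show ?thesis
    using that ex_not_in[OF blocked_subset] path_Cons_blocked assms by metis
qed

text \<open>The new element becomes a neighbour of both ends, so third elements of pairs with the
  last entry must be avoided too. This costs at most \<open>length xs - 3\<close> beyond
  \<open>blocked\<close>.\<close>

lemma path_close:
  assumes p: "ind_path xs" and len: "length xs \<ge> 3"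
    and k: "card L > 3 * length xs - 5 + card (thirds xs)"
  obtains y where "ind_cycle (y # xs)"
proof -
  obtain h ys q l where xs: "xs = h # ys @ [q, l]"
  proof -
    obtain h zs where 1: "xs = h # zs" using len by (cases xs) auto
    obtain zs' l where 2: "zs = zs' @ [l]" using len 1 by (cases zs rule: rev_cases) auto
    obtain ys q where 3: "zs' = ys @ [q]" using len 1 2 by (cases zs' rule: rev_cases) auto
    show ?thesis using that 1 2 3 by simp
  qed
  \<comment> \<open>The third elements of \<open>{h, l}\<close> and \<open>{q, l}\<close> are already blocked, so only \<open>ys\<close> is counted.\<close>
  define A where "A = blocked xs \<union> (\<Union>j\<in>set ys. third l j)"
  have "A \<subseteq> L"
    using blocked_subset[OF p] third_subset by (auto simp: A_def)
  have "card (\<Union>j\<in>set ys. third l j) \<le> length ys"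
    using card_third_Union_le[of "set ys" l] card_length[of ys] by simp
  then have "card A \<le> length xs + card (thirds xs) + (length xs - 2) + (length xs - 3)"
    unfolding A_def using card_Un_le[of "blocked xs" "\<Union>j\<in>set ys. third l j"]
      card_blocked_le[of xs] xs by simp
  then have "card A < card L" using k len by simp
  then obtain y where y: "y \<in> L" "y \<notin> A" using ex_not_in[OF \<open>A \<subseteq> L\<close>] by blast
  then have py: "ind_path (y # xs)"
    using path_Cons_blocked[OF p, of y] len by (simp add: A_def)
  have "l \<in> set (tl (tl xs))" by (cases ys) (auto simp: xs)
  then have "y \<notin> third h l" using y(2) by (auto simp: A_def blocked_def xs)
  moreover have "y \<notin> third q l"
    using y(2) third_subset_thirds[of q l "h # ys" "[]"] by (auto simp: A_def blocked_def xs)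
  moreover have "y \<notin> third l j" if "j \<in> set ys" for j
    using that y(2) by (auto simp: A_def)
  ultimately have "y \<notin> third l j" if "j \<in> set xs" for j
    using that not_in_third third_commute by (auto simp: xs)
  then have "third l y \<inter> set xs = {}"
    using third_rotate third_commute by blast
  then have "ind_cycle (y # xs)"
    using py len not_in_third by (auto simp: ind_cycle_def xs)
  then show ?thesis by (rule that)
qed

lemma path_pair: "a \<in> L \<Longrightarrow> b \<in> L \<Longrightarrow> a \<noteq> b \<Longrightarrow> ind_path [a, b]"
  using not_in_third by (auto simp: ind_path_def)

text \<open>Each added entry enlarges \<open>thirds\<close> by at most one element, starting from
  \<open>third a b\<close>. The last extension, from length \<open>m - 1\<close>, excludes at most
  \<open>2 * (m - 1) - 2 + (m - 3) + card (third a b)\<close> elements, whence the 7.\<close>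

lemma path_exists:
  assumes "a \<in> L" "b \<in> L" "a \<noteq> b"
    and "m \<ge> 2" and "card L + 7 > 3 * m + card (third a b)"
  shows "\<exists>xs. ind_path xs \<and> length xs = m \<and> card (thirds xs) + 2 \<le> m + card (third a b)"
  using assms(4,5)
proof (induction m rule: dec_induct)
  case base
  then show ?case
    using path_pair[OF assms(1-3)] by (intro exI[of _ "[a, b]"]) simp
next
  case (step j)
  then obtain xs where xs: "ind_path xs" "length xs = j"
    "card (thirds xs) + 2 \<le> j + card (third a b)" by auto
  have "card L > 2 * length xs - 2 + card (thirds xs)"
    using xs step.prems step.hyps by simp
  then obtain y where "y \<in> L" "ind_path (y # xs)"
    using path_extend[of xs] xs step.hyps by auto
  moreover have "card (thirds (y # xs)) \<le> Suc (card (thirds xs))"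
    using xs(2) step.hyps(1) by (intro card_thirds_Cons_le) auto
  ultimately show ?case
    using xs by (intro exI[of _ "y # xs"]) simp
qed

text \<open>Closing a path with \<open>i - 1\<close> entries excludes at most
  \<open>3 * (i - 1) - 5 + (i - 3) + card (third a b)\<close> elements, whence the 11. A starting
  pair without third element saves one.\<close>

lemma cycle_exists:
  assumes "a \<in> L" "b \<in> L" "a \<noteq> b"
    and "i \<ge> 4" and "card L + 11 > 4 * i + card (third a b)"
  shows "\<exists>xs. ind_cycle xs \<and> length xs = i"
proof -
  have "card L + 7 > 3 * (i - 1) + card (third a b)" using assms(4,5) by linarith
  then obtain xs where xs: "ind_path xs" "length xs = i - 1"
    "card (thirds xs) + 2 \<le> i - 1 + card (third a b)"
    using path_exists[OF assms(1-3), of "i - 1"] assms(4) by fastforce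
  moreover have "card L > 3 * length xs - 5 + card (thirds xs)"
    using xs assms(4,5) by linarith
  moreover have "length xs \<ge> 3" using xs assms(4) by linarith
  ultimately obtain y where "ind_cycle (y # xs)" using path_close by blast
  then show ?thesis using xs assms(4) by (intro exI[of _ "y # xs"]) simp
qed

lemma cycle_3_exists:
  assumes "card L \<ge> 4"
  shows "\<exists>xs. ind_cycle xs \<and> length xs = 3"
proof -
  have "\<not> card L \<le> Suc 0" using assms by simp
  then obtain a b where ab: "a \<in> L" "b \<in> L" "a \<noteq> b"
    using card_le_Suc0_iff_eq[OF finite_L] by blast
  have "2 * length [a, b] - 2 + card (thirds [a, b]) < card L"
    using card_third_le[of a b] assms by simp
  then obtain c where c: "ind_path (c # [a, b])"
    using path_extend[OF path_pair[OF ab]] by auto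
  \<comment> \<open>For three entries each pair condition says that they form no triple, so the
    closing pair adds nothing new.\<close>
  then have "ind_cycle [c, a, b]"
    using not_in_third third_rotate third_commute by (auto simp: ind_cycle_def ind_path_def)
  then show ?thesis by (intro exI[of _ "[c, a, b]"]) simp
qed

section \<open>Paths assembled from matched pairs\<close>

context
  fixes M :: "'a \<Rightarrow> 'a"
  assumes M_mem: "x \<in> L \<Longrightarrow> M x \<in> L"
    and M_neq: "x \<in> L \<Longrightarrow> M x \<noteq> x"
    and M_M: "x \<in> L \<Longrightarrow> M (M x) = x"
    and M_third: "x \<in> L \<Longrightarrow> third x (M x) = {}"
begin

lemma path_extend_pair:
  assumes p: "ind_path xs" and len: "length xs \<ge> 2" and M: "M ` set xs \<subseteq> set xs"
    and k: "card L > 2 * length xs - 2 + 2 * card (thirds xs)"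
  obtains x where "x \<in> L" "ind_path (M x # x # xs)"
proof -
  define A where "A = blocked xs \<union> M ` thirds xs"
  have "A \<subseteq> L"
    using blocked_subset[OF p] M_mem thirds_subset by (auto simp: A_def)
  have "card A \<le> card (blocked xs) + card (thirds xs)"
    unfolding A_def
    using card_Un_le[of "blocked xs" "M ` thirds xs"] card_image_le[of "thirds xs" M] by simp
  then have "card A < card L"
    using card_blocked_le[of xs] k len by simp
  then obtain x where x: "x \<in> L" "x \<notin> A" using ex_not_in[OF \<open>A \<subseteq> L\<close>] by blast
  then have px: "ind_path (x # xs)"
    using path_Cons_blocked[OF p, of x] len by (simp add: A_def)
  have free: "third (M x) x = {}" using M_third[OF x(1)] third_commute by simp
  have "M x \<notin> set xs"
    using M M_M x p by (metis A_def UnI1 blocked_def image_subset_iff)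
  moreover have "M x \<notin> thirds xs"
    using x M_M by (metis A_def UnI2 imageI)
  moreover have "M x \<notin> third x h" for h
    using free third_rotate third_commute by (metis empty_iff)
  moreover obtain h zs where "xs = h # zs" using len by (cases xs) auto
  ultimately have "ind_path (M x # x # xs)"
    using px x(1) M_mem M_neq free by (auto simp: ind_path_def)
  with x(1) show ?thesis by (rule that)
qed

text \<open>Each further matched pair contributes at most one third element, that of the pair
  joining it to the old path. The last step, from \<open>n - 1\<close> pairs, excludes at most
  \<open>4 * (n - 1) - 2 + 2 * (n - 2)\<close> elements, whence the 10.\<close>

lemma paired_path_exists:
  assumes "n \<ge> 1" and "card L + 10 > 6 * n" "L \<noteq> {}"
  shows "\<exists>xs. ind_path xs \<and> length xs = 2 * n \<and> M ` set xs \<subseteq> set xs \<and> card (thirds xs) + 1 \<le> n"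
  using assms(1,2)
proof (induction n rule: dec_induct)
  case base
  obtain x where x: "x \<in> L" using assms(3) by auto
  then show ?case
    using path_pair[OF x M_mem] M_neq M_M M_third by (intro exI[of _ "[x, M x]"]) fastforce
next
  case (step j)
  then obtain xs where xs: "ind_path xs" "length xs = 2 * j" "M ` set xs \<subseteq> set xs"
    "card (thirds xs) + 1 \<le> j" by auto
  have "card L > 2 * length xs - 2 + 2 * card (thirds xs)"
    using xs(2,4) step.prems step.hyps(1) by simp
  then obtain x where x: "x \<in> L" "ind_path (M x # x # xs)"
    using path_extend_pair[of xs] xs step.hyps by auto
  have "thirds (M x # x # xs) = thirds (x # xs)"
    using M_third[OF x(1)] third_commute by simp
  then have "card (thirds (M x # x # xs)) \<le> Suc (card (thirds xs))"
    using card_thirds_Cons_le[of xs x] xs(2) step.hyps(1) by (cases xs) simp_all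
  then show ?case
    using x xs M_M by (intro exI[of _ "M x # x # xs"]) auto
qed

lemma paired_cycle_exists:
  assumes "i \<ge> 4" and "2 * card L + 16 \<ge> 7 * i"
  shows "\<exists>xs. ind_cycle xs \<and> length xs = i"
proof -
  \<comment> \<open>As many matched pairs as fit before the closing element.\<close>
  define n where "n = (i - 1) div 2"
  have n: "n \<ge> 1" using assms(1) by (simp add: n_def)
  have "L \<noteq> {}" using assms by auto
  have "i = 2 * n + 1 \<or> i = 2 * n + 2" using assms(1) unfolding n_def by presburger
  moreover have "card L + 10 > 6 * n" using assms n calculation by linarith
  then obtain xs where xs: "ind_path xs" "length xs = 2 * n" "card (thirds xs) + 1 \<le> n"
    using paired_path_exists[OF n _ \<open>L \<noteq> {}\<close>] by auto
  have "\<exists>zs. ind_path zs \<and> length zs = i - 1 \<and> card (thirds zs) \<le> (i - 2) div 2"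
    using calculation
  proof
    assume "i = 2 * n + 1"
    then show ?thesis using xs n by (intro exI[of _ xs]) auto
  next
    \<comment> \<open>For even \<open>i\<close> one unmatched element is added before closing, at
      the cost of at most one more third element.\<close>
    assume i: "i = 2 * n + 2"
    have "card L > 2 * length xs - 2 + card (thirds xs)" using xs assms i n by linarith
    then obtain y where "ind_path (y # xs)"
      using path_extend[of xs] xs n by auto
    moreover have "card (thirds (y # xs)) \<le> Suc (card (thirds xs))"
      using xs(2) n by (intro card_thirds_Cons_le) auto
    ultimately show ?thesis using xs i by (intro exI[of _ "y # xs"]) auto
  qed
  then obtain zs where zs: "ind_path zs" "length zs = i - 1" "card (thirds zs) \<le> (i - 2) div 2" by auto
  moreover have "card L > 3 * length zs - 5 + card (thirds zs)"
    using zs assms by linarith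
  moreover have "length zs \<ge> 3" using zs assms(1) by linarith
  ultimately obtain y where "ind_cycle (y # zs)" using path_close by blast
  then show ?thesis using zs assms(1) by (intro exI[of _ "y # zs"]) simp
qed

end

end

section \<open>Cycles in the Levi graph\<close>

text \<open>Arcs are pairs of vertices, so \<open>f\<close> also determines the map on arcs. It is
  an isomorphism from the cycle onto the subgraph induced on the image of \<open>f\<close>.\<close>

lemma has_induced_cycleI:
  assumes n: "n \<ge> 3" and wf: "wf_digraph (with_proj G)"
    and inj: "inj_on f {..<n}" and verts: "f ` {..<n} \<subseteq> pverts G"
    and arcs: "\<And>a b. a < n \<Longrightarrow> b < n \<Longrightarrow>
      (f a, f b) \<in> parcs G \<longleftrightarrow> (a, b) \<in> parcs (cycle_graph n)"
  shows "has_induced_cycle G n"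
proof -
  let ?C = "with_proj (cycle_graph n)"
  define H where "H = with_proj G \<restriction> (f ` {..<n})"
  define h where "h = \<lparr>iso_verts = f, iso_arcs = map_prod f f, iso_head = snd, iso_tail = fst\<rparr>"
  interpret C: pair_graph "cycle_graph n" by (rule pair_graph_cycle_graph[OF n])
  interpret G: wf_digraph "with_proj G" by (rule wf)
  have C_sub: "a < n" "b < n" if "(a, b) \<in> parcs (cycle_graph n)" for a b
    using that by (auto simp: cycle_graph_def)
  have "arcs H = map_prod f f ` parcs (cycle_graph n)"
  proof (intro equalityI subsetI)
    fix e assume "e \<in> arcs H"
    then obtain a b where "a < n" "b < n" "e = (f a, f b)" "(f a, f b) \<in> parcs G"
      by (cases e) (auto simp: H_def induce_subgraph_def)
    then show "e \<in> map_prod f f ` parcs (cycle_graph n)"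
      using arcs by (intro image_eqI[of _ _ "(a, b)"]) auto
  next
    fix e assume "e \<in> map_prod f f ` parcs (cycle_graph n)"
    then obtain a b where "(a, b) \<in> parcs (cycle_graph n)" "e = (f a, f b)" by auto
    then show "e \<in> arcs H"
      using arcs C_sub by (auto simp: H_def induce_subgraph_def)
  qed
  then have H: "H = app_iso h ?C"
    by (simp add: H_def h_def app_iso_def induce_subgraph_def cycle_graph_def)
  have iso: "pre_digraph.digraph_isomorphism ?C h"
    unfolding pre_digraph.digraph_isomorphism_def
  proof (intro conjI)
    show "inj_on (iso_verts h) (verts ?C)"
      using inj by (simp add: h_def cycle_graph_def)
    show "inj_on (iso_arcs h) (arcs ?C)"
      using map_prod_inj_on[OF inj inj] C_sub
      by (auto simp: h_def intro!: inj_on_subset[of "map_prod f f" "{..<n} \<times> {..<n}"])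
  qed (use C.wf_digraph_axioms in \<open>auto simp: h_def\<close>)
  then have "digraph_iso ?C H"
    using H by (auto simp: digraph_iso_def)
  then have "digraph_iso H ?C"
    using digraph_iso_swap C.wf_digraph_axioms by blast
  moreover have "induced_subgraph H (with_proj G)"
    unfolding H_def using verts by (intro G.induced_induce) simp
  ultimately show ?thesis
    unfolding has_induced_cycle_def by blast
qed

section \<open>Arcs of even cycles\<close>

lemma cycle_graph_arc_sym:
  "(a, b) \<in> parcs (cycle_graph n) \<longleftrightarrow> (b, a) \<in> parcs (cycle_graph n)"
  unfolding cycle_graph_def by (simp, blast)

text \<open>Even positions will carry lines and odd positions points: point \<open>m\<close> sits
  between line \<open>m\<close> and its cyclic successor.\<close>

lemma cycle_graph_arc_even_odd:
  assumes "j < i" "m < i"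
  shows "(2 * j, 2 * m + 1) \<in> parcs (cycle_graph (2 * i)) \<longleftrightarrow> j = m \<or> j = Suc m mod i"
proof -
  have "(2 * m + 1 + 1) mod (2 * i) = 2 * (Suc m mod i)"
    using mult_mod_right[of 2 "Suc m" i] by simp
  then show ?thesis
    using assms by (auto simp: cycle_graph_def)
qed

lemma cycle_graph_arc_parity:
  assumes "(a, b) \<in> parcs (cycle_graph (2 * i))"
  shows "even a \<longleftrightarrow> odd b"
proof -
  have even_mod: "even (x mod (2 * i)) \<longleftrightarrow> even x" for x :: nat
    by (simp add: dvd_mod_iff)
  have "b = Suc a mod (2 * i) \<or> a = Suc b mod (2 * i)"
    using assms by (simp add: cycle_graph_def)
  then show ?thesis
    using even_mod[of "Suc a"] even_mod[of "Suc b"] by (metis even_Suc)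
qed

section \<open>Intersections of lines in the projective plane\<close>

lemma proj_point_Int:
  assumes "proj_line a" "proj_line b" "a \<noteq> b"
  shows "proj_point (a \<inter> b)"
proof -
  have sub: "vec.subspace a" "vec.subspace b" "vec.subspace (a \<inter> b)"
    and dims: "vec.dim a = 2" "vec.dim b = 2"
    using assms by (auto simp: proj_line_def vec.subspace_inter)
  \<comment> \<open>The dimension formula leaves at least 2 + 2 - 3 for the intersection.\<close>
  have "vec.dim {x + y |x y. x \<in> a \<and> y \<in> b} \<le> 3"
    using dim_subset_UNIV_cart_gen[of "{x + y |x y. x \<in> a \<and> y \<in> b}"] by simp
  then have "vec.dim (a \<inter> b) \<ge> 1"
    using vec.dim_sums_Int[OF sub(1,2)] dims by linarith
  moreover have "\<not> vec.dim (a \<inter> b) \<ge> 2"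
    using vec.subspace_dim_equal[OF sub(3,1)] vec.subspace_dim_equal[OF sub(3,2)] dims assms(3)
    by auto
  ultimately show ?thesis
    using sub by (simp add: proj_point_def)
qed

lemma proj_point_eq_Int:
  assumes "proj_line a" "proj_line b" "a \<noteq> b" "proj_point p" "p \<subseteq> a" "p \<subseteq> b"
  shows "p = a \<inter> b"
  using vec.subspace_dim_equal[of p "a \<inter> b"] proj_point_Int[OF assms(1-3)] assms
  by (simp add: proj_point_def)

text \<open>Stated with a common point to make the symmetry in the three lines immediate;
  \<open>concurrent_iff\<close> gives the asymmetric form used for computing.\<close>

definition concurrent ::
  "(complex ^ 3) set set \<Rightarrow> (complex ^ 3) set \<Rightarrow> (complex ^ 3) set \<Rightarrow> (complex ^ 3) set \<Rightarrow> bool" where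
  "concurrent L a b c \<longleftrightarrow> a \<in> L \<and> b \<in> L \<and> c \<in> L \<and> a \<noteq> b \<and> b \<noteq> c \<and> a \<noteq> c \<and>
     (\<exists>p. proj_point p \<and> p \<subseteq> a \<and> p \<subseteq> b \<and> p \<subseteq> c)"

section \<open>Points and concurrent triples of an arrangement\<close>

context
  fixes L :: "(complex ^ 3) set set"
  assumes arr: "line_arrangement L"
begin

lemma proj_line_arr: "a \<in> L \<Longrightarrow> proj_line a"
  using arr by (simp add: line_arrangement_def)

lemma finite_arr: "finite L"
  using arr by (simp add: line_arrangement_def)

lemma concurrent_iff:
  "concurrent L a b c \<longleftrightarrow> a \<in> L \<and> b \<in> L \<and> c \<in> L \<and> a \<noteq> b \<and> b \<noteq> c \<and> a \<noteq> c \<and> a \<inter> b \<subseteq> c"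
    (is "_ \<longleftrightarrow> ?R")
proof
  assume "concurrent L a b c"
  then show ?R
    unfolding concurrent_def using proj_point_eq_Int[of a b] proj_line_arr by blast
next
  assume R: ?R
  then have "proj_point (a \<inter> b)"
    using proj_point_Int[of a b] proj_line_arr by blast
  with R show "concurrent L a b c"
    unfolding concurrent_def by blast
qed

lemma Int_in_Sing:
  assumes "a \<in> L" "b \<in> L" "a \<noteq> b"
  shows "a \<inter> b \<in> Sing L"
proof -
  have "card {a, b} \<le> multiplicity_of L (a \<inter> b)"
    unfolding multiplicity_of_def using finite_arr assms
    by (intro card_mono) (auto simp: lies_on_def)
  then show ?thesis
    using proj_point_Int[of a b] proj_line_arr assms by (simp add: Sing_def)
qed

lemma SingE:
  assumes "p \<in> Sing L" "a \<in> L" "lies_on p a"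
  obtains b where "b \<in> L" "a \<noteq> b" "p = a \<inter> b"
proof -
  have "\<not> {l \<in> L. lies_on p l} \<subseteq> {a}"
    using card_mono[of "{a}" "{l \<in> L. lies_on p l}"] assms(1)
    by (auto simp: Sing_def multiplicity_of_def)
  then obtain b where "b \<in> L" "lies_on p b" "a \<noteq> b" by auto
  then show ?thesis
    using that proj_point_eq_Int[of a b p] proj_line_arr assms
    by (auto simp: Sing_def lies_on_def)
qed

text \<open>Lets a vanishing number of points be read as absence of points, since
  \<open>card\<close> of an infinite set is 0 as well.\<close>

lemma finite_Sing: "finite (Sing L)"
proof (rule finite_subset)
  show "Sing L \<subseteq> (\<lambda>(a, b). a \<inter> b) ` (L \<times> L)"
  proof
    fix p assume p: "p \<in> Sing L"
    then have "{l \<in> L. lies_on p l} \<noteq> {}"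
      by (auto simp: Sing_def multiplicity_of_def simp del: Collect_empty_eq)
    then obtain a where a: "a \<in> L" "lies_on p a" by auto
    then obtain b where "b \<in> L" "p = a \<inter> b" using SingE[OF p] by metis
    with a show "p \<in> (\<lambda>(a, b). a \<inter> b) ` (L \<times> L)" by auto
  qed
qed (simp add: finite_arr)

lemma multiplicity_le_3:
  assumes "\<forall>r>3. t\<^bsub>L\<^esub> r = 0" "p \<in> Sing L"
  shows "multiplicity_of L p \<le> 3"
proof (rule ccontr)
  assume "\<not> ?thesis"
  then have "card {q \<in> Sing L. multiplicity_of L q = multiplicity_of L p} = 0"
    using assms(1) by (simp add: num_points_def)
  then show False
    using assms(2) finite_Sing by auto
qed

text \<open>Two different third lines would give the point \<open>a \<inter> b\<close> multiplicity
  at least 4.\<close>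

lemma partial_triple_system_concurrent:
  assumes "\<forall>r>3. t\<^bsub>L\<^esub> r = 0"
  shows "partial_triple_system L (concurrent L)"
proof
  fix a b c d
  assume c: "concurrent L a b c" and d: "concurrent L a b d"
  show "c = d"
  proof (rule ccontr)
    assume "c \<noteq> d"
    then have "card {a, b, c, d} = 4"
      using c d by (simp add: concurrent_iff)
    moreover have "card {a, b, c, d} \<le> multiplicity_of L (a \<inter> b)"
      unfolding multiplicity_of_def using c d finite_arr
      by (intro card_mono) (auto simp: concurrent_iff lies_on_def)
    moreover have "multiplicity_of L (a \<inter> b) \<le> 3"
      using c Int_in_Sing by (intro multiplicity_le_3[OF assms]) (auto simp: concurrent_iff)
    ultimately show False by simp
  qed
qed (auto simp: concurrent_def finite_arr)

section \<open>Double points as pairs of lines without a third line\<close>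

lemma double_point_partner:
  assumes "a \<in> L" "p \<in> double_points_on L a"
  obtains b where "b \<in> L" "a \<noteq> b" "p = a \<inter> b" "\<And>c. \<not> concurrent L a b c"
proof -
  obtain b where b: "b \<in> L" "a \<noteq> b" "p = a \<inter> b"
    using SingE[of p a] assms by (auto simp: double_points_on_def)
  have "\<not> concurrent L a b c" for c
  proof
    assume "concurrent L a b c"
    then have "card {a, b, c} = 3" "{a, b, c} \<subseteq> {l \<in> L. lies_on p l}"
      using b by (auto simp: concurrent_iff lies_on_def)
    then have "3 \<le> multiplicity_of L p"
      unfolding multiplicity_of_def
      using card_mono[of "{l \<in> L. lies_on p l}" "{a, b, c}"] finite_arr by simp
    then show False
      using assms(2) by (simp add: double_points_on_def)
  qed
  with b show ?thesis by (rule that)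
qed

lemma Int_in_double_points_on:
  assumes "a \<in> L" "b \<in> L" "a \<noteq> b" "\<And>c. \<not> concurrent L a b c"
  shows "a \<inter> b \<in> double_points_on L a"
proof -
  have "{l \<in> L. lies_on (a \<inter> b) l} = {a, b}"
    using assms by (auto simp: concurrent_iff lies_on_def)
  then have "multiplicity_of L (a \<inter> b) = 2"
    using assms by (simp add: multiplicity_of_def)
  then show ?thesis
    using Int_in_Sing assms by (simp add: double_points_on_def lies_on_def)
qed

lemma wf_digraph_levi_graph: "wf_digraph (with_proj (levi_graph L))"
  by unfold_locales (auto simp: levi_graph_def)

text \<open>The lines alternate with the intersections of consecutive lines. By \<open>ind\<close>,
  such a point lies on no other line of the sequence, so the Levi graph has no chords.\<close>

lemma has_induced_cycle_levi_graph:
  assumes len: "length xs \<ge> 3" and dist: "distinct xs" and sub: "set xs \<subseteq> L"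
    and ind: "\<And>j c. j < length xs \<Longrightarrow> concurrent L (xs ! j) (xs ! (Suc j mod length xs)) c \<Longrightarrow> c \<notin> set xs"
  shows "has_induced_cycle (levi_graph L) (2 * length xs)"
proof -
  define i where "i = length xs"
  define P where "P m = xs ! m \<inter> xs ! (Suc m mod i)" for m
  define f where "f v = (if even v then Inr (xs ! (v div 2)) else Inl (P (v div 2)))" for v
  have i: "i \<ge> 3" using len by (simp add: i_def)
  have mem: "xs ! j \<in> L" if "j < i" for j
    using that sub by (auto simp: i_def)
  have nth_eq: "xs ! j = xs ! m \<longleftrightarrow> j = m" if "j < i" "m < i" for j m
    using that dist nth_eq_iff_index_eq by (auto simp: i_def)
  have mod_less: "Suc m mod i < i" for m using i by simp
  have mod_neq: "Suc m mod i \<noteq> m" if "m < i" for m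
    using that i by (cases "Suc m = i") auto
  have P_Sing: "P m \<in> Sing L" if "m < i" for m
    unfolding P_def using that mem mod_less mod_neq nth_eq Int_in_Sing by metis
  have on: "lies_on (P m) (xs ! j) \<longleftrightarrow> j = m \<or> j = Suc m mod i" if jm: "j < i" "m < i" for j m
  proof
    assume l: "lies_on (P m) (xs ! j)"
    show "j = m \<or> j = Suc m mod i"
    proof (rule ccontr)
      assume "\<not> (j = m \<or> j = Suc m mod i)"
      then have "concurrent L (xs ! m) (xs ! (Suc m mod i)) (xs ! j)"
        using l jm mem mod_less mod_neq[OF jm(2)] nth_eq by (auto simp: concurrent_iff lies_on_def P_def)
      then show False
        using ind[of m "xs ! j"] jm by (simp add: i_def)
    qed
  qed (auto simp: P_def lies_on_def)
  have P_inj: "m = m'" if "P m = P m'" "m < i" "m' < i" for m m'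
  proof (rule ccontr)
    assume "m \<noteq> m'"
    then have "m' = Suc m mod i" "m = Suc m' mod i"
      using on[of m m'] on[of m' m] on[of m m] on[of m' m'] that by auto
    \<comment> \<open>Two indices that are cyclic successors of each other force
      \<open>i \<le> 2\<close>.\<close>
    then show False
      using i that(2,3) by (simp add: mod_Suc split: if_splits)
  qed
  have "has_induced_cycle (levi_graph L) (2 * i)"
  proof (rule has_induced_cycleI[where f = f])
    show "2 * i \<ge> 3" using i by simp
    show "inj_on f {..<2 * i}"
    proof (rule inj_onI)
      fix a b assume ab: "a \<in> {..<2 * i}" "b \<in> {..<2 * i}" "f a = f b"
      then have "(even a \<longleftrightarrow> even b) \<and> a div 2 = b div 2"
        using P_inj nth_eq by (auto simp: f_def split: if_splits)
      then show "a = b"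
        by (metis even_two_times_div_two odd_two_times_div_two_succ)
    qed
    show "f ` {..<2 * i} \<subseteq> pverts (levi_graph L)"
      using P_Sing mem by (auto simp: f_def levi_graph_def)
  next
    have line_point: "(Inr (xs ! j), Inl (P m)) \<in> parcs (levi_graph L) \<longleftrightarrow>
        (2 * j, 2 * m + 1) \<in> parcs (cycle_graph (2 * i))" if "j < i" "m < i" for j m
      using on[OF that] mem P_Sing that cycle_graph_arc_even_odd[OF that]
      by (auto simp: levi_graph_def)
    have sym: "(Inl p, Inr l) \<in> parcs (levi_graph L) \<longleftrightarrow> (Inr l, Inl p) \<in> parcs (levi_graph L)" for p l
      by (auto simp: levi_graph_def)
    fix a b assume ab: "a < 2 * i" "b < 2 * i"
    show "(f a, f b) \<in> parcs (levi_graph L) \<longleftrightarrow> (a, b) \<in> parcs (cycle_graph (2 * i))"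
    proof (cases "even a \<longleftrightarrow> even b")
      case True
      \<comment> \<open>Both graphs are bipartite, so equal parity means no arc on either
        side.\<close>
      then show ?thesis
        using cycle_graph_arc_parity[of a b i] by (auto simp: f_def levi_graph_def)
    next
      case False
      then consider j m where "a = 2 * j" "b = 2 * m + 1" | j m where "a = 2 * m + 1" "b = 2 * j"
        by (metis evenE oddE)
      then show ?thesis
      proof cases
        case 1
        then show ?thesis using ab line_point[of j m] by (simp add: f_def)
      next
        case 2
        then show ?thesis
          using ab line_point[of j m] sym cycle_graph_arc_sym[of a b "2 * i"] by (simp add: f_def)
      qed
    qed
  qed (rule wf_digraph_levi_graph)
  then show ?thesis by (simp add: i_def)
qed

end

theorem theorem4p6:
  fixes L :: "(complex ^ 3) set set" and k :: nat
  assumes "line_arrangement L" and "card L = k"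
    and "t\<^bsub>L\<^esub> 3 \<noteq> 0" and "\<forall>r>3. t\<^bsub>L\<^esub> r = 0"
    and "k \<ge> 6"
  shows "(odd k \<longrightarrow>
            (\<forall>i::nat. 3 \<le> i \<and> int i \<le> \<lfloor>(real k + 9) / 4\<rfloor> \<longrightarrow>
               has_induced_cycle (levi_graph L) (2 * i))) \<and>
         (even k \<and> (\<exists>l\<in>L. card (double_points_on L l) > 1) \<longrightarrow>
            (\<forall>i::nat. 3 \<le> i \<and> int i \<le> \<lfloor>(real k + 11) / 4\<rfloor> \<longrightarrow>
               has_induced_cycle (levi_graph L) (2 * i))) \<and>
         (even k \<and> (\<forall>l\<in>L. card (double_points_on L l) = 1) \<longrightarrow>
            (\<forall>i::nat. 3 \<le> i \<and> int i \<le> \<lfloor>(2 * real k + 16) / 7\<rfloor> \<longrightarrow>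
               has_induced_cycle (levi_graph L) (2 * i)))"
proof -
  note arr = assms(1)
  interpret partial_triple_system L "concurrent L"
    by (rule partial_triple_system_concurrent[OF arr assms(4)])
  have third_empty: "third a b = {} \<longleftrightarrow> (\<forall>c. \<not> concurrent L a b c)" for a b
    by (auto simp: third_def)
  have levi: "has_induced_cycle (levi_graph L) (2 * i)" if ex: "\<exists>xs. ind_cycle xs \<and> length xs = i" for i
  proof -
    obtain xs where xs: "ind_cycle xs" "length xs = i" using ex by auto
    have "c \<notin> set xs"
      if "j < length xs" "concurrent L (xs ! j) (xs ! (Suc j mod length xs)) c" for j c
      using ind_cycle_nth[OF xs(1) that(1)] that(2) unfolding third_def by blast
    then have "has_induced_cycle (levi_graph L) (2 * length xs)"
      using xs(1) by (intro has_induced_cycle_levi_graph[OF arr]) (auto simp: ind_cycle_def ind_path_def)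
    then show ?thesis by (simp add: xs(2))
  qed
  have levi': "has_induced_cycle (levi_graph L) (2 * i)"
    if "3 \<le> i" "i \<ge> 4 \<Longrightarrow> \<exists>xs. ind_cycle xs \<and> length xs = i" for i
    using that levi[of i] cycle_3_exists assms(2,5) by (cases "i = 3") auto
  show ?thesis
  proof (intro conjI impI allI; (elim conjE)?)
    fix i :: nat
    assume i: "3 \<le> i" "int i \<le> \<lfloor>(real k + 9) / 4\<rfloor>"
    have "4 * i \<le> k + 9" using i(2) by (simp add: le_floor_iff)
    have "\<not> card L \<le> Suc 0" using assms by simp
    then obtain a b where "a \<in> L" "b \<in> L" "a \<noteq> b"
      using card_le_Suc0_iff_eq[OF finite_L] by blast
    then show "has_induced_cycle (levi_graph L) (2 * i)"
      using cycle_exists[of a b i] card_third_le[of a b] \<open>4 * i \<le> k + 9\<close> assms(2)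
      by (intro levi'[OF i(1)]) simp
  next
    fix i :: nat
    assume i: "3 \<le> i" "int i \<le> \<lfloor>(real k + 11) / 4\<rfloor>"
      and "even k" "\<exists>l\<in>L. card (double_points_on L l) > 1"
    have "4 * i \<le> k + 11" using i(2) by (simp add: le_floor_iff)
    \<comment> \<open>Parity makes the inequality strict: \<open>k + 11\<close> is odd.\<close>
    with \<open>even k\<close> have k: "4 * i < k + 11" by presburger
    obtain a p where a: "a \<in> L" "p \<in> double_points_on L a"
      using \<open>\<exists>l\<in>L. card (double_points_on L l) > 1\<close> by (metis card.empty ex_in_conv not_less_zero)
    then obtain b where "b \<in> L" "a \<noteq> b" "third a b = {}"
      using double_point_partner[OF arr a] third_empty by metis
    then show "has_induced_cycle (levi_graph L) (2 * i)"
      using cycle_exists[of a b i] k a assms(2) by (intro levi'[OF i(1)]) simp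
  next
    fix i :: nat
    assume i: "3 \<le> i" "int i \<le> \<lfloor>(2 * real k + 16) / 7\<rfloor>"
      and one: "\<forall>l\<in>L. card (double_points_on L l) = 1"
    have k: "7 * i \<le> 2 * k + 16" using i(2) by (simp add: le_floor_iff)
    define partner where "partner a b \<longleftrightarrow> a \<in> L \<and> b \<in> L \<and> a \<noteq> b \<and> third a b = {}" for a b
    have ex: "\<exists>b. partner a b" if "a \<in> L" for a
    proof -
      obtain p where "p \<in> double_points_on L a"
        using one \<open>a \<in> L\<close> by (metis card_1_singletonE insertI1)
      then show ?thesis
        using double_point_partner[OF arr \<open>a \<in> L\<close>] third_empty \<open>a \<in> L\<close> by (metis partner_def)
    qed
    have unique: "b = c" if "partner a b" "partner a c" for a b c
    proof (rule ccontr)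
      assume "b \<noteq> c"
      have "a \<inter> b \<in> double_points_on L a" "a \<inter> c \<in> double_points_on L a" "a \<in> L"
        using that Int_in_double_points_on[OF arr] third_empty by (auto simp: partner_def)
      \<comment> \<open>The only double point on \<open>a\<close> is both intersections, so
        \<open>c\<close> would be a third line through \<open>a \<inter> b\<close>.\<close>
      then have "a \<inter> b = a \<inter> c"
        using one by (metis card_1_singletonE singletonD)
      then have "concurrent L a b c"
        using that \<open>b \<noteq> c\<close> by (auto simp: concurrent_iff[OF arr] partner_def)
      then show False
        using that third_empty by (auto simp: partner_def)
    qed
    define M where "M a = (SOME b. partner a b)" for a
    have M: "partner a (M a)" if "a \<in> L" for a
      unfolding M_def using ex[OF that] by (rule someI_ex)
    \<comment> \<open>Since \<open>partner\<close> is symmetric and single-valued, the chosen map is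
      an involution.\<close>
    have MM: "M (M a) = a" if "a \<in> L" for a
    proof (rule unique)
      show "partner (M a) (M (M a))" using M that by (auto simp: partner_def)
      show "partner (M a) a" using M[OF that] third_commute by (auto simp: partner_def)
    qed
    have "\<exists>xs. ind_cycle xs \<and> length xs = i" if "i \<ge> 4"
      using paired_cycle_exists[of M i] M MM that k assms(2) by (force simp: partner_def)
    then show "has_induced_cycle (levi_graph L) (2 * i)"
      by (rule levi'[OF i(1)])
  qed
qed

end
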